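(* A function $\phi\colon\mathbb{R}\to\mathbb{R}$ is a maximal general Dual-Feasible Function if and only if the following conditions hold: (i) $\phi(0)=0$; (ii) $\phi$ is superadditive, i.e. $\phi(x)+\phi(y)\le\phi(x+y)$ for all $x,y\in\mathbb{R}$; (iii) $\phi(x)\ge 0$ for all real $x\ge 0$; (iv) for all $r\in\mathbb{R}$, $\phi(r)=\inf\left\{\frac1k\bigl(1-\phi(1-kr)\bigr) : k \text{ a positive integer}\right\}$.
   Context: A function $\phi\colon\mathbb{R}\to\mathbb{R}$ is a general Dual-Feasible Function (DFF) if for every finite family $(x_i)_{i\in I}$ of real numbers, $\sum_{i\in I}x_i\le 1$ implies $\sum_{i\in I}\phi(x_i)\le 1$. A general DFF $\phi$ is maximal if it is pointwise non-dominated: there is no general DFF $\psi\neq\phi$ with $\psi(x)\ge\phi(x)$ for all $x\in\mathbb{R}$. *)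

theory Defs
  imports Complex_Main "HOL-Library.Extended_Real"
begin

text \<open>
  Families are indexed by finite sets of natural numbers. Every finite family can be
  reindexed in this way, and values may repeat within a family.
\<close>

definition general_dff :: "(real \<Rightarrow> real) \<Rightarrow> bool" where
  "general_dff \<phi> \<longleftrightarrow>
     (\<forall>(I :: nat set) (x :: nat \<Rightarrow> real). finite I \<longrightarrow>
        (\<Sum>i\<in>I. x i) \<le> 1 \<longrightarrow> (\<Sum>i\<in>I. \<phi> (x i)) \<le> 1)"

definition maximal_general_dff :: "(real \<Rightarrow> real) \<Rightarrow> bool" where
  "maximal_general_dff \<phi> \<longleftrightarrow>
     general_dff \<phi> \<and> \<not> (\<exists>\<psi>. general_dff \<psi> \<and> \<psi> \<noteq> \<phi> \<and> (\<forall>x. \<psi> x \<ge> \<phi> x))"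

definition superadditive :: "(real \<Rightarrow> real) \<Rightarrow> bool" where
  "superadditive \<phi> \<longleftrightarrow> (\<forall>x y. \<phi> x + \<phi> y \<le> \<phi> (x + y))"

text \<open>
  The infimum of a set of values of such functions is to be taken in the extended reals:
  \<open>Inf\<close> on type \<open>real\<close> is unspecified on sets that are not bounded below.
\<close>

end

(* A maximal DFF cannot be raised at a single point, so phi r is at least every value c for
   which k c plus the phi-values of ys is at most 1 whenever k r plus the sum of ys is.
   Taking for c the values 0 (for r >= 0), phi x + phi y (for r = x + y) and any real below
   the infimum gives (iii), (ii) and (iv); (i) follows since many copies of 0 sum to 0.
   Conversely, (ii) and (iii) make phi monotone, so phi is a DFF because phi 1 <= 1 by (i)
   and (iv); and by (iv) raising phi r is refuted by k copies of r together with 1 - k r. *)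
theory Submission
  imports Defs
begin

text \<open>Lists can be appended, replicated and filtered, which the later arguments do constantly.
  A list is a family indexed by its positions; conversely, a finite index set is listed in
  increasing order.\<close>

lemma general_dff_iff_list:
  "general_dff \<phi> \<longleftrightarrow> (\<forall>xs. sum_list xs \<le> 1 \<longrightarrow> sum_list (map \<phi> xs) \<le> 1)"
proof (intro iffI allI impI)
  fix xs :: "real list"
  assume dff: "general_dff \<phi>" and le: "sum_list xs \<le> 1"
  have eq: "sum_list (map f xs) = (\<Sum>i<length xs. f (xs ! i))" for f :: "real \<Rightarrow> real"
    by (simp add: sum_list_sum_nth atLeast0LessThan)
  have "(\<Sum>i<length xs. xs ! i) \<le> 1"
    using le eq[of "\<lambda>x. x"] by simp
  then have "(\<Sum>i<length xs. \<phi> (xs ! i)) \<le> 1"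
    using dff unfolding general_dff_def by blast
  then show "sum_list (map \<phi> xs) \<le> 1"
    by (simp add: eq)
next
  assume *: "\<forall>xs. sum_list xs \<le> 1 \<longrightarrow> sum_list (map \<phi> xs) \<le> 1"
  show "general_dff \<phi>"
    unfolding general_dff_def
  proof (intro allI impI)
    fix I :: "nat set" and x :: "nat \<Rightarrow> real"
    assume I: "finite I" and le: "(\<Sum>i\<in>I. x i) \<le> 1"
    have eq: "sum_list (map f (sorted_list_of_set I)) = (\<Sum>i\<in>I. f i)" for f :: "nat \<Rightarrow> real"
      using I by (simp add: sum_list_distinct_conv_sum_set)
    show "(\<Sum>i\<in>I. \<phi> (x i)) \<le> 1"
      using *[rule_format, of "map x (sorted_list_of_set I)"] le by (simp add: eq comp_def)
  qed
qed

lemma general_dffD: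
  "general_dff \<phi> \<Longrightarrow> sum_list xs \<le> 1 \<Longrightarrow> sum_list (map \<phi> xs) \<le> 1"
  by (simp add: general_dff_iff_list)

lemma general_dff_replicateD:
  assumes "general_dff \<phi>" "real k * r + sum_list ys \<le> 1"
  shows "real k * \<phi> r + sum_list (map \<phi> ys) \<le> 1"
  using general_dffD[OF assms(1), of "replicate k r @ ys"] assms(2)
  by (simp add: sum_list_replicate)

text \<open>Isolates the occurrences of \<open>r\<close>, the only entries on which
  \<open>\<phi>(r := c)\<close> and \<open>\<phi>\<close> can differ.\<close>

lemma sum_list_map_split_value:
  fixes f :: "real \<Rightarrow> real"
  shows "sum_list (map f xs) =
    real (count_list xs r) * f r + sum_list (map f (filter (\<lambda>x. x \<noteq> r) xs))"
  by (induction xs) (auto simp: algebra_simps)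

text \<open>If \<open>c\<close> exceeded \<open>\<phi> r\<close>, then \<open>\<phi>(r := c)\<close>
  would strictly dominate \<open>\<phi>\<close>. It would also be a DFF: in any list the
  \<open>k\<close> occurrences of \<open>r\<close> contribute \<open>k * c\<close>, the other
  entries keep their values, and \<open>raise\<close> bounds the total.\<close>

lemma maximal_general_dff_geI:
  assumes max: "maximal_general_dff \<phi>"
    and raise: "\<And>k ys. real k * r + sum_list ys \<le> 1 \<Longrightarrow> real k * c + sum_list (map \<phi> ys) \<le> 1"
  shows "c \<le> \<phi> r"
proof (rule ccontr)
  assume less: "\<not> c \<le> \<phi> r"
  let ?\<psi> = "\<phi>(r := c)"
  have "general_dff ?\<psi>"
    unfolding general_dff_iff_list
  proof (intro allI impI)
    fix xs :: "real list"
    let ?ys = "filter (\<lambda>x. x \<noteq> r) xs"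
    assume "sum_list xs \<le> 1"
    then have "real (count_list xs r) * r + sum_list ?ys \<le> 1"
      using sum_list_map_split_value[of "\<lambda>x. x" xs r] by simp
    then have "real (count_list xs r) * c + sum_list (map \<phi> ?ys) \<le> 1"
      by (rule raise)
    moreover have "map ?\<psi> ?ys = map \<phi> ?ys"
      by simp
    ultimately show "sum_list (map ?\<psi> xs) \<le> 1"
      using sum_list_map_split_value[of ?\<psi> xs r] by simp
  qed
  moreover have "?\<psi> \<noteq> \<phi>"
    using less by (auto simp: fun_eq_iff)
  moreover have "\<forall>x. ?\<psi> x \<ge> \<phi> x"
    using less by simp
  ultimately show False
    using max unfolding maximal_general_dff_def by blast
qed

lemma maximal_general_dff_nonneg:
  assumes max: "maximal_general_dff \<phi>" and "0 \<le> r"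
  shows "0 \<le> \<phi> r"
proof (rule maximal_general_dff_geI[OF max])
  fix k ys
  assume "real k * r + sum_list ys \<le> 1"
  \<comment> \<open>Discarding the nonnegative copies of \<open>r\<close> keeps the sum at most
    1.\<close>
  moreover have "0 \<le> real k * r"
    using \<open>0 \<le> r\<close> by simp
  ultimately have "sum_list ys \<le> 1"
    by linarith
  then show "real k * 0 + sum_list (map \<phi> ys) \<le> 1"
    using max general_dffD unfolding maximal_general_dff_def by simp
qed

lemma maximal_general_dff_superadditive:
  assumes max: "maximal_general_dff \<phi>"
  shows "superadditive \<phi>"
  unfolding superadditive_def
proof (intro allI)
  fix x y
  show "\<phi> x + \<phi> y \<le> \<phi> (x + y)"
  proof (rule maximal_general_dff_geI[OF max])
    fix k ys
    assume "real k * (x + y) + sum_list ys \<le> 1"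
    \<comment> \<open>Replacing \<open>k\<close> copies of \<open>x + y\<close> by \<open>k\<close>
      copies each of \<open>x\<close> and \<open>y\<close> leaves the sum unchanged.\<close>
    then show "real k * (\<phi> x + \<phi> y) + sum_list (map \<phi> ys) \<le> 1"
      using max general_dff_replicateD[of \<phi> k x "replicate k y @ ys"]
      unfolding maximal_general_dff_def
      by (simp add: sum_list_replicate algebra_simps)
  qed
qed

lemma general_dff_zero_le:
  assumes "general_dff \<phi>"
  shows "\<phi> 0 \<le> 0"
proof (rule ccontr)
  assume "\<not> \<phi> 0 \<le> 0"
  then obtain k where "1 < real k * \<phi> 0"
    using reals_Archimedean3[of "\<phi> 0"] by auto
  then show False
    using general_dff_replicateD[OF assms, of k 0 "[]"] by simp
qed

lemma maximal_general_dff_zero: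
  assumes max: "maximal_general_dff \<phi>"
  shows "\<phi> 0 = 0"
proof (rule antisym)
  show "\<phi> 0 \<le> 0"
    using max unfolding maximal_general_dff_def by (simp add: general_dff_zero_le)
  show "0 \<le> \<phi> 0"
    by (rule maximal_general_dff_nonneg[OF max]) simp
qed

text \<open>Superadditivity is iterated along the list; \<open>\<phi> 0 = 0\<close> settles the
  empty list.\<close>

lemma superadditive_sum_list_le:
  assumes "superadditive \<phi>" "\<phi> 0 = 0"
  shows "sum_list (map \<phi> xs) \<le> \<phi> (sum_list xs)"
proof (induction xs)
  case (Cons x xs)
  have "\<phi> x + \<phi> (sum_list xs) \<le> \<phi> (x + sum_list xs)"
    using assms(1) unfolding superadditive_def by blast
  with Cons.IH show ?case by simp
qed (simp add: assms(2))

lemma superadditive_nonneg_mono: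
  assumes "superadditive \<phi>" "\<forall>x\<ge>0. \<phi> x \<ge> 0" "x \<le> y"
  shows "\<phi> x \<le> \<phi> y"
proof -
  have "\<phi> x + \<phi> (y - x) \<le> \<phi> (x + (y - x))"
    using assms(1) unfolding superadditive_def by blast
  moreover have "0 \<le> \<phi> (y - x)"
    using assms(2,3) by simp
  ultimately show ?thesis by simp
qed

lemma maximal_general_dff_eq_INF:
  assumes max: "maximal_general_dff \<phi>"
  shows "ereal (\<phi> r) =
    (INF k \<in> {k :: nat. k > 0}. ereal (1 / real k * (1 - \<phi> (1 - real k * r))))"
    (is "_ = (INF k \<in> _. ereal (?t k))")
proof -
  have dff: "general_dff \<phi>"
    using max unfolding maximal_general_dff_def by blast
  \<comment> \<open>This half holds for every DFF: \<open>k\<close> copies of \<open>r\<close>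
    together with \<open>1 - k * r\<close> sum to exactly 1.\<close>
  have le_INF: "ereal (\<phi> r) \<le> (INF k \<in> {k. k > 0}. ereal (?t k))"
  proof (rule INF_greatest)
    fix k :: nat
    assume "k \<in> {k. k > 0}"
    then show "ereal (\<phi> r) \<le> ereal (?t k)"
      using general_dff_replicateD[OF dff, of k r "[1 - real k * r]"]
      by (simp add: field_simps)
  qed
  have super: "superadditive \<phi>" and nonneg: "\<forall>x\<ge>0. \<phi> x \<ge> 0"
    using maximal_general_dff_superadditive[OF max] maximal_general_dff_nonneg[OF max] by auto
  have zero: "\<phi> 0 = 0"
    by (rule maximal_general_dff_zero[OF max])
  have "(INF k \<in> {k. k > 0}. ereal (?t k)) \<le> ereal (\<phi> r)"
  proof (rule ccontr)
    assume "\<not> ?thesis"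
    then obtain c where c: "\<phi> r < c" "ereal c < (INF k \<in> {k. k > 0}. ereal (?t k))"
      using ereal_dense2[of "ereal (\<phi> r)"] by (auto simp: not_le)
    have "c \<le> \<phi> r"
    proof (rule maximal_general_dff_geI[OF max])
      fix k ys
      assume le: "real k * r + sum_list ys \<le> 1"
      show "real k * c + sum_list (map \<phi> ys) \<le> 1"
      \<comment> \<open>The infimum ranges over positive \<open>k\<close> only; for
        \<open>k = 0\<close> the claim is the DFF property of \<open>ys\<close>.\<close>
      proof (cases "k = 0")
        case True
        then show ?thesis
          using general_dffD[OF dff] le by simp
      next
        case False
        then have "ereal c < ereal (?t k)"
          by (intro less_le_trans[OF c(2) INF_lower]) simp
        then have "real k * c \<le> 1 - \<phi> (1 - real k * r)"
          using False by (simp add: field_simps)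
        \<comment> \<open>The single entry \<open>1 - k * r\<close> is the worst case among all
          admissible \<open>ys\<close>, which is why an infimum over \<open>k\<close> alone
          suffices.\<close>
        moreover have "sum_list (map \<phi> ys) \<le> \<phi> (1 - real k * r)"
          using superadditive_sum_list_le[OF super zero, of ys]
            superadditive_nonneg_mono[OF super nonneg, of "sum_list ys" "1 - real k * r"] le
          by simp
        ultimately show ?thesis by simp
      qed
    qed
    with c(1) show False by simp
  qed
  with le_INF show ?thesis
    by (rule antisym)
qed

lemma maximal_general_dffI:
  assumes zero: "\<phi> 0 = 0" and super: "superadditive \<phi>" and nonneg: "\<forall>x\<ge>0. \<phi> x \<ge> 0"
    and inf: "\<And>r. ereal (\<phi> r) =
      (INF k \<in> {k :: nat. k > 0}. ereal (1 / real k * (1 - \<phi> (1 - real k * r))))"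
  shows "maximal_general_dff \<phi>"
proof -
  \<comment> \<open>The instance \<open>r = 0\<close>, \<open>k = 1\<close> reads
    \<open>\<phi> 0 \<le> 1 - \<phi> 1\<close>.\<close>
  have "ereal (\<phi> 0) \<le> ereal (1 / real 1 * (1 - \<phi> (1 - real 1 * 0)))"
    unfolding inf[of 0] by (rule INF_lower) simp
  then have one: "\<phi> 1 \<le> 1"
    by (simp add: zero)
  have "general_dff \<phi>"
    unfolding general_dff_iff_list
  proof (intro allI impI)
    fix xs :: "real list"
    assume "sum_list xs \<le> 1"
    then show "sum_list (map \<phi> xs) \<le> 1"
      using superadditive_sum_list_le[OF super zero, of xs]
        superadditive_nonneg_mono[OF super nonneg, of "sum_list xs" 1] one
      by simp
  qed
  moreover have "\<psi> = \<phi>" if dff: "general_dff \<psi>" and ge: "\<forall>x. \<psi> x \<ge> \<phi> x" for \<psi>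
  proof (rule ext, rule antisym)
    fix r
    show "\<phi> r \<le> \<psi> r"
      using ge by blast
    \<comment> \<open>Since \<open>k * \<psi> r \<le> 1 - \<psi> (1 - k * r) \<le> 1 - \<phi> (1 - k
      * r)\<close>, the value \<open>\<psi> r\<close> is a lower bound of the set whose infimum is
      \<open>\<phi> r\<close>.\<close>
    have "ereal (\<psi> r) \<le> ereal (\<phi> r)"
      unfolding inf[of r]
    proof (rule INF_greatest)
      fix k :: nat
      assume "k \<in> {k. k > 0}"
      moreover have "real k * \<psi> r + \<psi> (1 - real k * r) \<le> 1"
        using general_dff_replicateD[OF dff, of k r "[1 - real k * r]"] by simp
      moreover have "\<phi> (1 - real k * r) \<le> \<psi> (1 - real k * r)"
        using ge by blast
      ultimately show "ereal (\<psi> r) \<le> ereal (1 / real k * (1 - \<phi> (1 - real k * r)))"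
        by (simp add: field_simps)
    qed
    then show "\<psi> r \<le> \<phi> r"
      by simp
  qed
  ultimately show ?thesis
    unfolding maximal_general_dff_def by blast
qed

theorem theoremB3:
  fixes \<phi> :: "real \<Rightarrow> real"
  shows "maximal_general_dff \<phi> \<longleftrightarrow>
    \<phi> 0 = 0 \<and>
    superadditive \<phi> \<and>
    (\<forall>x \<ge> 0. \<phi> x \<ge> 0) \<and>
    (\<forall>r. ereal (\<phi> r) =
       (INF k \<in> {k :: nat. k > 0}. ereal (1 / real k * (1 - \<phi> (1 - real k * r)))))"
  (is "?max \<longleftrightarrow> _ \<and> _ \<and> _ \<and> ?inf")
proof
  assume max: ?max
  show "\<phi> 0 = 0 \<and> superadditive \<phi> \<and> (\<forall>x \<ge> 0. \<phi> x \<ge> 0) \<and> ?inf"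
    using maximal_general_dff_zero[OF max] maximal_general_dff_superadditive[OF max]
      maximal_general_dff_nonneg[OF max] maximal_general_dff_eq_INF[OF max]
    by blast
next
  assume "\<phi> 0 = 0 \<and> superadditive \<phi> \<and> (\<forall>x \<ge> 0. \<phi> x \<ge> 0) \<and> ?inf"
  then show ?max
    by (elim conjE, intro maximal_general_dffI) (assumption | erule spec)+
qed

end
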